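(* Let $B=\{(b_i,d_i)\}_{i=1}^n$ be a strict barcode. Then the rank $\rho(g(B))$ of $g(B)$ in the combinatorial barcode poset $(L(2^n)/\mathfrak{S}_n,\leq_c)$ is $$\rho(g(B))=\sum_{(i,j):\,b_i<b_j}\mathrm{cross\#}(i,j).$$
   Context: A barcode with $n$ bars is a finite multiset of intervals on the real line $B=\{(b_i,d_i)\}_{i=1}^n$ with $b_i<d_i$ for all $i\in[n]=\{1,\ldots,n\}$. It is strict if $b_i\ne d_j$ for all $i,j\in[n]$, and $b_i\neq b_j$, $d_i\ne d_j$ for all $i\neq j$. For bars $i,j$ with $b_i<b_j$, the crossing number is $\mathrm{cross\#}(i,j)=0$ if $d_i<b_j$ (disjoint), $1$ if $b_j<d_i<d_j$ (stepped), and $2$ if $d_j<d_i$ (nested). $L(2^n)$ is the set of all permutations (words) of the multiset $\{1^2,2^2,\ldots,n^2\}$. Let $S=\{1_1,1_2,2_1,2_2,\ldots,n_1,n_2\}$ be totally ordered lexicographically ($1_1<1_2<2_1<\cdots<n_2$). The map $\iota:L(2^n)\to\mathfrak{S}_S$ replaces the first and second occurrence of each $i$ in the word by $i_1$ and $i_2$. For $\pi\in\mathfrak{S}_S$ (one-line notation), $\mathrm{inv}(\pi)$ is the set of pairs $(\pi_a,\pi_b)$ with $a<b$, $\pi_a>\pi_b$. The multinomial Newman order on $L(2^n)$ is: $s\le t$ iff $\mathrm{inv}(\iota(s))\subseteq\mathrm{inv}(\iota(t))$. $\mathfrak{S}_n$ acts on $L(2^n)$ by applying a permutation to every letter; $[s]$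 is the orbit of $s$. For $s\in L(2^n)$ let $\tau_s\in\mathfrak{S}_n$ be the permutation whose one-line notation is the subword of first occurrences in $s$, and set $\psi([s])=\tau_s^{-1}\circ s$ (independent of the representative $s$). Define $[s]\leq_c[t]$ iff $\psi([s])\le\psi([t])$. The poset $(L(2^n)/\mathfrak{S}_n,\leq_c)$ is graded with a minimum element; $\rho$ denotes its rank function (with the minimum having rank $0$). For a strict barcode $B$, order the $2n$ distinct endpoints increasingly; $f(B)\in L(2^n)$ is the word whose $r$-th letter is the index of the bar to which the $r$-th smallest endpoint belongs, and $g(B)=[f(B)]$. *)

theory Defs
  imports Complex_Main "HOL-Combinatorics.Permutations" "HOL-Combinatorics.Multiset_Permutations"
begin

(* A barcode with n bars is an indexed family B of endpoint pairs; only the values B i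
   for i in {1..n} are meaningful. *)

abbreviation birth :: "(nat \<Rightarrow> real \<times> real) \<Rightarrow> nat \<Rightarrow> real" where
  "birth B i \<equiv> fst (B i)"

abbreviation death :: "(nat \<Rightarrow> real \<times> real) \<Rightarrow> nat \<Rightarrow> real" where
  "death B i \<equiv> snd (B i)"

definition barcode :: "nat \<Rightarrow> (nat \<Rightarrow> real \<times> real) \<Rightarrow> bool" where
  "barcode n B \<longleftrightarrow> (\<forall>i\<in>{1..n}. birth B i < death B i)"

definition strict_barcode :: "nat \<Rightarrow> (nat \<Rightarrow> real \<times> real) \<Rightarrow> bool" where
  "strict_barcode n B \<longleftrightarrow> barcode n B \<and>
     (\<forall>i\<in>{1..n}. \<forall>j\<in>{1..n}. birth B i \<noteq> death B j) \<and>
     (\<forall>i\<in>{1..n}. \<forall>j\<in>{1..n}. i \<noteq> j \<longrightarrow> birth B i \<noteq> birth B j \<and> death B i \<noteq> death B j)"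

(* Only used when birth B i < birth B j. For a strict barcode the three cases (disjoint,
   stepped, nested) are then exhaustive, so the last branch is never taken. *)

definition crossing_number :: "(nat \<Rightarrow> real \<times> real) \<Rightarrow> nat \<Rightarrow> nat \<Rightarrow> nat" where
  "crossing_number B i j =
     (if death B i < birth B j then 0
      else if birth B j < death B i \<and> death B i < death B j then 1
      else if death B j < death B i then 2
      else undefined)"

definition double_words :: "nat \<Rightarrow> nat list set" where
  "double_words n = permutations_of_multiset (repeat_mset 2 (mset_set {1..n}))"

(* The letter i_k is represented by the pair (i, k). *)

definition label_occurrences :: "nat list \<Rightarrow> (nat \<times> nat) list" where
  "label_occurrences s = map (\<lambda>a. (s ! a, Suc (count_list (take a s) (s ! a)))) [0..<length s]"

definition inversions :: "(nat \<times> nat) list \<Rightarrow> ((nat \<times> nat) \<times> (nat \<times> nat)) set" where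
  "inversions p = {(p ! a, p ! c) | a c.
     a < c \<and> c < length p \<and> (p ! c, p ! a) \<in> less_than <*lex*> less_than}"

definition newman_le :: "nat list \<Rightarrow> nat list \<Rightarrow> bool" where
  "newman_le s t \<longleftrightarrow> inversions (label_occurrences s) \<subseteq> inversions (label_occurrences t)"

definition word_orbit :: "nat \<Rightarrow> nat list \<Rightarrow> nat list set" where
  "word_orbit n s = {map \<sigma> s | \<sigma>. \<sigma> permutes {1..n}}"

definition combinatorial_barcodes :: "nat \<Rightarrow> nat list set set" where
  "combinatorial_barcodes n = word_orbit n ` double_words n"

definition first_occurrences :: "nat list \<Rightarrow> nat list" where
  "first_occurrences s = nths s {a. s ! a \<notin> set (take a s)}"

definition birth_perm :: "nat \<Rightarrow> nat list \<Rightarrow> nat \<Rightarrow> nat" where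
  "birth_perm n s = permutation_of_list (zip [1..<Suc n] (first_occurrences s))"

(* the_elem expresses that the normalised word does not depend on the representative s. *)

definition canonical_word :: "nat \<Rightarrow> nat list set \<Rightarrow> nat list" where
  "canonical_word n X = the_elem ((\<lambda>s. map (inv (birth_perm n s)) s) ` X)"

definition combinatorial_le :: "nat \<Rightarrow> nat list set \<Rightarrow> nat list set \<Rightarrow> bool" where
  "combinatorial_le n X Y \<longleftrightarrow> newman_le (canonical_word n X) (canonical_word n Y)"

definition covers_on :: "'a set \<Rightarrow> ('a \<Rightarrow> 'a \<Rightarrow> bool) \<Rightarrow> 'a \<Rightarrow> 'a \<Rightarrow> bool" where
  "covers_on P le x y \<longleftrightarrow> x \<in> P \<and> y \<in> P \<and> le x y \<and> x \<noteq> y \<and>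
     (\<forall>z\<in>P. le x z \<and> le z y \<longrightarrow> z = x \<or> z = y)"

definition rank_function :: "'a set \<Rightarrow> ('a \<Rightarrow> 'a \<Rightarrow> bool) \<Rightarrow> ('a \<Rightarrow> nat) \<Rightarrow> bool" where
  "rank_function P le \<rho> \<longleftrightarrow>
     (\<forall>x\<in>P. (\<forall>y\<in>P. le x y) \<longrightarrow> \<rho> x = 0) \<and>
     (\<forall>x\<in>P. \<forall>y\<in>P. le x y \<and> x \<noteq> y \<longrightarrow> \<rho> x < \<rho> y) \<and>
     (\<forall>x y. covers_on P le x y \<longrightarrow> \<rho> y = Suc (\<rho> x))"

(* The value at x of the rank function of a graded poset with a minimum. It is determined
   only if a rank function exists and all rank functions agree at x. *)

definition poset_rank :: "'a set \<Rightarrow> ('a \<Rightarrow> 'a \<Rightarrow> bool) \<Rightarrow> 'a \<Rightarrow> nat" where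
  "poset_rank P le x = (THE k. \<exists>\<rho>. rank_function P le \<rho> \<and> \<rho> x = k)"

definition bar_of_endpoint :: "nat \<Rightarrow> (nat \<Rightarrow> real \<times> real) \<Rightarrow> real \<Rightarrow> nat" where
  "bar_of_endpoint n B x = (THE i. i \<in> {1..n} \<and> (x = birth B i \<or> x = death B i))"

definition barcode_word :: "nat \<Rightarrow> (nat \<Rightarrow> real \<times> real) \<Rightarrow> nat list" where
  "barcode_word n B =
     map (bar_of_endpoint n B) (sorted_list_of_set (birth B ` {1..n} \<union> death B ` {1..n}))"

definition barcode_class :: "nat \<Rightarrow> (nat \<Rightarrow> real \<times> real) \<Rightarrow> nat list set" where
  "barcode_class n B = word_orbit n (barcode_word n B)"

end

theory Submission
  imports Defs
begin

text \<open>
  Write a canonical word as its list of labels. The inversions of such a list determine it, and if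
  the inversions of \<open>s\<close> are properly contained in those of \<open>t\<close>, then some adjacent pair of \<open>s\<close>
  appears in the opposite order in \<open>t\<close>. Swapping that pair in \<open>s\<close> creates exactly one new inversion,
  which is an inversion of \<open>t\<close>, and keeps \<open>s\<close> canonical, because every order relation required of a
  canonical list already holds in \<open>t\<close>. Hence covers add exactly one inversion, and the rank is the
  number of inversions. For bars \<open>i\<close>, \<open>j\<close> with \<open>i\<close> born first, the inversions between their labels are
  the pairs of an endpoint of \<open>j\<close> preceding an endpoint of \<open>i\<close>: none, one or two for disjoint, stepped
  and nested bars.
\<close>

section \<open>Pairs of entries in order of appearance\<close>

text \<open>For a list with distinct entries this is the strict linear order of appearance. Kept as
  a set of pairs, it lets inversions, canonicity and adjacent swaps all be handled through
  inclusions of sets.\<close>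

primrec order_pairs :: "'a list \<Rightarrow> ('a \<times> 'a) set" where
  "order_pairs [] = {}"
| "order_pairs (x # xs) = {x} \<times> set xs \<union> order_pairs xs"

lemma order_pairs_append [simp]:
  "order_pairs (xs @ ys) = order_pairs xs \<union> order_pairs ys \<union> set xs \<times> set ys"
  by (induction xs) auto

text \<open>Bridges the recursive definition and the index form inside \<open>inversions\<close>.
  The induction runs from the end of the list because appending an entry leaves earlier indices
  unchanged.\<close>

lemma order_pairs_nth: "order_pairs xs = {(xs ! a, xs ! c) | a c. a < c \<and> c < length xs}"
  (is "_ = ?N xs")
proof (induction xs rule: rev_induct)
  case (snoc x xs)
  have "?N (xs @ [x]) = ?N xs \<union> set xs \<times> {x}"
  proof (intro equalityI subsetI)
    fix p assume "p \<in> ?N (xs @ [x])"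
    then obtain a c where "p = ((xs @ [x]) ! a, (xs @ [x]) ! c)" "a < c" "c < Suc (length xs)"
      by auto
    then show "p \<in> ?N xs \<union> set xs \<times> {x}"
      by (cases "c = length xs") (auto simp: nth_append less_Suc_eq)
  next
    fix p assume "p \<in> ?N xs \<union> set xs \<times> {x}"
    then consider a c where "p = (xs ! a, xs ! c)" "a < c" "c < length xs"
      | a where "p = (xs ! a, x)" "a < length xs"
      by (auto simp: in_set_conv_nth)
    then show "p \<in> ?N (xs @ [x])"
    proof cases
      case (1 a c)
      then show ?thesis
        by (intro CollectI exI[of _ a] exI[of _ c] conjI) (simp_all add: nth_append)
    next
      case (2 a)
      then show ?thesis
        by (intro CollectI exI[of _ a] exI[of _ "length xs"] conjI) (simp_all add: nth_append)
    qed
  qed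
  then show ?case using snoc by simp
qed simp

lemma order_pairs_subset: "order_pairs xs \<subseteq> set xs \<times> set xs"
  by (induction xs) auto

lemma order_pairs_map: "order_pairs (map f xs) = map_prod f f ` order_pairs xs"
  by (induction xs) (auto simp: image_Un)

lemma order_pairs_filter: "order_pairs (filter P xs) \<subseteq> order_pairs xs"
  by (induction xs) auto

lemma order_pairs_asym:
  assumes "distinct xs" "(x, y) \<in> order_pairs xs"
  shows "(y, x) \<notin> order_pairs xs"
  using assms order_pairs_subset by (induction xs) fastforce+

lemma order_pairs_irrefl: "distinct xs \<Longrightarrow> (x, x) \<notin> order_pairs xs"
  using order_pairs_asym by metis

lemma order_pairs_total:
  assumes "x \<in> set xs" "y \<in> set xs" "x \<noteq> y"
  shows "(x, y) \<in> order_pairs xs \<or> (y, x) \<in> order_pairs xs"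
  using assms by (induction xs) auto

lemma order_pairs_trans:
  assumes "distinct xs" "(x, y) \<in> order_pairs xs" "(y, z) \<in> order_pairs xs"
  shows "(x, z) \<in> order_pairs xs"
  using assms
proof (induction xs)
  case (Cons w xs)
  then show ?case using order_pairs_subset[of xs] by auto
qed simp

lemma sorted_wrt_order_pairs: "sorted_wrt P xs \<longleftrightarrow> (\<forall>(x, y) \<in> order_pairs xs. P x y)"
  by (induction xs) auto

text \<open>One inclusion suffices because both relations are total on the same entries. If the
  heads differed, each of them would precede the other in \<open>ys\<close>.\<close>

lemma order_pairs_unique:
  assumes "distinct xs" "distinct ys" "set xs = set ys" "order_pairs xs \<subseteq> order_pairs ys"
  shows "xs = ys"
  using assms
proof (induction xs arbitrary: ys)
  case (Cons x xs)
  obtain y ys' where ys: "ys = y # ys'" using Cons.prems(3) by (cases ys) auto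
  have "x = y"
  proof (rule ccontr)
    assume "x \<noteq> y"
    have "x \<in> set (y # ys')" "y \<in> set (x # xs)" using Cons.prems(3) ys by auto
    then have "(y, x) \<in> order_pairs ys" "(x, y) \<in> order_pairs (x # xs)"
      using \<open>x \<noteq> y\<close> ys by auto
    then have "(x, y) \<in> order_pairs ys" using Cons.prems(4) by blast
    then show False
      using \<open>(y, x) \<in> order_pairs ys\<close> order_pairs_asym Cons.prems(2) by metis
  qed
  moreover have "xs = ys'"
  proof (rule Cons.IH)
    show "set xs = set ys'"
      using Cons.prems(1-3) ys \<open>x = y\<close> by (metis distinct.simps(2) insert_ident list.simps(15))
    show "order_pairs xs \<subseteq> order_pairs ys'"
      using Cons.prems(1,4) ys \<open>x = y\<close> order_pairs_subset[of xs] by auto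
  qed (use Cons.prems ys in auto)
  ultimately show ?case using ys by simp
qed simp

text \<open>Otherwise all neighbours in \<open>xs\<close> are ordered as in \<open>ys\<close>;
  transitivity extends this to every pair of \<open>xs\<close>, and the lists coincide.\<close>

lemma ex_adjacent_disorder:
  assumes "distinct ys" "distinct xs" "set xs = set ys" "xs \<noteq> ys"
  obtains us x y vs where "xs = us @ [x, y] @ vs" "(x, y) \<notin> order_pairs ys"
proof -
  have "\<exists>us x y vs. xs = us @ [x, y] @ vs \<and> (x, y) \<notin> order_pairs ys"
  proof (rule ccontr)
    assume none: "\<not> ?thesis"
    have "successively (\<lambda>x y. (x, y) \<in> order_pairs ys) xs"
      unfolding successively_conv_nth
    proof (intro allI impI)
      fix i assume "Suc i < length xs"
      then have "xs = take i xs @ [xs ! i, xs ! Suc i] @ drop (Suc (Suc i)) xs"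
        by (metis Cons_nth_drop_Suc Suc_lessD append_Cons append_Nil append_take_drop_id)
      then show "(xs ! i, xs ! Suc i) \<in> order_pairs ys" using none by blast
    qed
    moreover have "transp (\<lambda>x y. (x, y) \<in> order_pairs ys)"
      using order_pairs_trans[OF assms(1)] by (auto intro: transpI)
    ultimately have "sorted_wrt (\<lambda>x y. (x, y) \<in> order_pairs ys) xs"
      by (simp add: successively_conv_sorted_wrt)
    then have "order_pairs xs \<subseteq> order_pairs ys" by (auto simp: sorted_wrt_order_pairs)
    then show False using assms order_pairs_unique by blast
  qed
  then show thesis using that by blast
qed

section \<open>Labelled words and their inversions\<close>

definition label_less :: "nat \<times> nat \<Rightarrow> nat \<times> nat \<Rightarrow> bool" where
  "label_less u v \<longleftrightarrow> (u, v) \<in> less_than <*lex*> less_than"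

lemma label_less_pair [simp]: "label_less (i, k) (j, l) \<longleftrightarrow> i < j \<or> i = j \<and> k < l"
  by (auto simp: label_less_def)

lemma label_less_linear: "label_less u v \<or> u = v \<or> label_less v u"
  by (cases u; cases v) auto

lemma label_less_asym: "label_less u v \<Longrightarrow> \<not> label_less v u"
  by (cases u; cases v) auto

lemma inversions_order_pairs: "inversions p = {(u, v) \<in> order_pairs p. label_less v u}"
  unfolding inversions_def order_pairs_nth label_less_def by blast

text \<open>Keeping the pairs in terms of \<open>xs\<close> allows inversions to be counted before
  the labels are renamed; only the comparison of labels sees \<open>f\<close>.\<close>

lemma inversions_map:
  "inversions (map f xs) =
     map_prod f f ` {(u, v) \<in> order_pairs xs. label_less (f v) (f u)}"
  unfolding inversions_order_pairs order_pairs_map by auto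

lemma finite_inversions [simp]: "finite (inversions p)"
proof (rule finite_subset)
  show "inversions p \<subseteq> set p \<times> set p"
    using order_pairs_subset unfolding inversions_order_pairs by blast
qed simp

text \<open>The inversions settle the relative order of every two labels: labels that stand in
  opposite orders in the two lists give an inversion of exactly one of them.\<close>

lemma inversions_eq_imp_eq:
  assumes "distinct xs" "distinct ys" "set xs = set ys" "inversions xs = inversions ys"
  shows "xs = ys"
proof (rule order_pairs_unique)
  show "order_pairs xs \<subseteq> order_pairs ys"
  proof clarify
    fix u1 u2 v1 v2
    assume uv: "((u1, u2), (v1, v2)) \<in> order_pairs xs" (is "(?u, ?v) \<in> _")
    show "(?u, ?v) \<in> order_pairs ys"
    proof (rule ccontr)
      assume not: "(?u, ?v) \<notin> order_pairs ys"
      have "?u \<noteq> ?v" using uv order_pairs_irrefl assms(1) by metis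
      moreover have "?u \<in> set ys" "?v \<in> set ys" using uv order_pairs_subset assms(3) by blast+
      ultimately have vu: "(?v, ?u) \<in> order_pairs ys" using order_pairs_total not by metis
      have "(?v, ?u) \<notin> order_pairs xs" using uv order_pairs_asym assms(1) by metis
      then show False
        using vu uv not assms(4) label_less_linear[of ?u ?v] \<open>?u \<noteq> ?v\<close>
        unfolding inversions_order_pairs by blast
    qed
  qed
qed (use assms in auto)

section \<open>Lists of labels that arise from words\<close>

definition well_labelled :: "(nat \<times> nat) list \<Rightarrow> bool" where
  "well_labelled L \<longleftrightarrow> distinct L \<and>
     (\<forall>(i, k) \<in> set L. 1 \<le> k \<and> (\<forall>l. 1 \<le> l \<and> l < k \<longrightarrow> ((i, l), (i, k)) \<in> order_pairs L))"

lemma label_occurrences_Nil [simp]: "label_occurrences [] = []"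
  by (simp add: label_occurrences_def)

lemma label_occurrences_snoc [simp]:
  "label_occurrences (s @ [x]) = label_occurrences s @ [(x, Suc (count_list s x))]"
  by (simp add: label_occurrences_def nth_append)

lemma map_fst_label_occurrences [simp]: "map fst (label_occurrences s) = s"
  by (induction s rule: rev_induct) auto

lemma set_label_occurrences: "set (label_occurrences s) = {(i, k). 1 \<le> k \<and> k \<le> count_list s i}"
  by (induction s rule: rev_induct) (auto simp: le_Suc_eq split: if_splits)

text \<open>With \<open>label_occurrences_map_fst\<close> this makes the well labelled lists exactly
  those of the form \<open>label_occurrences s\<close>.\<close>

lemma well_labelled_label_occurrences: "well_labelled (label_occurrences s)"
proof (induction s rule: rev_induct)
  case (snoc x s)
  then show ?case
    unfolding well_labelled_def by (auto simp: set_label_occurrences)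
qed (simp add: well_labelled_def)

text \<open>For a last label (i, k), the labels (i, 1), ..., (i, k - 1) occur earlier and (i, k)
  does not, while the earlier labels of i are numbered from 1 up to the count of i. Hence k is one
  more than that count.\<close>

lemma label_occurrences_map_fst:
  assumes "well_labelled L"
  shows "label_occurrences (map fst L) = L"
  using assms
proof (induction L rule: rev_induct)
  case (snoc z L)
  obtain i k where z: "z = (i, k)" by (cases z)
  have notin: "(i, k) \<notin> set L" using snoc.prems z by (simp add: well_labelled_def)
  have "well_labelled L"
    using snoc.prems unfolding well_labelled_def z by auto
  then have IH: "label_occurrences (map fst L) = L" by (rule snoc.IH)
  then have mem: "(j, l) \<in> set L \<longleftrightarrow> 1 \<le> l \<and> l \<le> count_list (map fst L) j" for j l
    using set_label_occurrences[of "map fst L"] by (metis (no_types, lifting) case_prodD case_prodI mem_Collect_eq)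
  have "1 \<le> k" and below: "\<And>l. 1 \<le> l \<Longrightarrow> l < k \<Longrightarrow> (i, l) \<in> set L"
    using snoc.prems order_pairs_subset[of L] notin unfolding well_labelled_def z by fastforce+
  have "k = Suc (count_list (map fst L) i)"
  proof -
    have "\<not> k \<le> count_list (map fst L) i" using notin mem \<open>1 \<le> k\<close> by blast
    moreover have "k - 1 \<le> count_list (map fst L) i"
    proof (cases "k = 1")
      case False
      then have "(i, k - 1) \<in> set L" using below \<open>1 \<le> k\<close> by simp
      then show ?thesis using mem by blast
    qed simp
    ultimately show ?thesis by simp
  qed
  then show ?case using IH z by simp
qed simp

lemma label_occurrences_map:
  assumes "inj \<sigma>"
  shows "label_occurrences (map \<sigma> s) = map (apfst \<sigma>) (label_occurrences s)"
  by (induction s rule: rev_induct) (simp_all add: count_list_map_conv[OF assms])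

section \<open>First occurrences of letters\<close>

lemma first_occurrences_Nil [simp]: "first_occurrences [] = []"
  by (simp add: first_occurrences_def)

lemma first_occurrences_snoc [simp]:
  "first_occurrences (s @ [x]) = first_occurrences s @ (if x \<in> set s then [] else [x])"
proof -
  \<comment> \<open>Only positions below \<open>length s\<close> matter to \<open>nths s\<close>,
    and on these the two conditions agree.\<close>
  have "nths s {a. (s @ [x]) ! a \<notin> set (take a (s @ [x]))} = nths s {a. s ! a \<notin> set (take a s)}"
    unfolding nths_def
    by (intro arg_cong[where f = "map fst"] filter_cong refl) (auto simp: set_zip nth_append)
  then show ?thesis by (simp add: first_occurrences_def nths_append)
qed

lemma set_first_occurrences [simp]: "set (first_occurrences s) = set s"
  by (induction s rule: rev_induct) auto

lemma distinct_first_occurrences [simp]: "distinct (first_occurrences s)"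
  by (induction s rule: rev_induct) auto

lemma first_occurrences_map:
  "inj \<sigma> \<Longrightarrow> first_occurrences (map \<sigma> s) = map \<sigma> (first_occurrences s)"
  by (induction s rule: rev_induct) (auto simp: inj_def)

text \<open>A letter is new exactly when its count so far is 0, which gives its label the second
  component 1. Orders of birth thereby become orders of labels.\<close>

lemma filter_label_occurrences:
  "filter (\<lambda>u. snd u = 1) (label_occurrences s) = map (\<lambda>i. (i, 1)) (first_occurrences s)"
  by (induction s rule: rev_induct) (auto simp: count_list_0_iff)

section \<open>Canonical representatives of orbits\<close>

lemma double_words_iff:
  "s \<in> double_words n \<longleftrightarrow> (\<forall>i. count_list s i = (if i \<in> {1..n} then 2 else 0))"
proof -
  have "s \<in> double_words n \<longleftrightarrow> (\<forall>i. count (mset s) i = count (repeat_mset 2 (mset_set {1..n})) i)"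
    by (simp add: double_words_def permutations_of_multiset_def multiset_eq_iff)
  then show ?thesis by (simp add: count_mset_set' count_mset)
qed

lemma set_double_words: "s \<in> double_words n \<Longrightarrow> set s = {1..n}"
  unfolding double_words_iff set_eq_iff
  by (metis count_list_0_iff zero_neq_numeral)

lemma map_fst_in_double_words:
  fixes L :: "(nat \<times> nat) list"
  assumes "distinct L" "set L = {1..n} \<times> {1..2}"
  shows "map fst L \<in> double_words n"
proof -
  have "count_list (map fst L) i = (if i \<in> {1..n} then 2 else 0)" for i
  proof -
    have "count_list (map fst L) i = length (filter (\<lambda>u. fst u = i) L)"
      by (simp add: count_list_eq_length_filter filter_map o_def eq_commute)
    also have "\<dots> = card {u \<in> set L. fst u = i}"
      using assms(1) distinct_card[of "filter (\<lambda>u. fst u = i) L"] by simp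
    also have "{u \<in> set L. fst u = i} = (if i \<in> {1..n} then {i} \<times> {1..2::nat} else {})"
      using assms(2) by auto
    finally show ?thesis by simp
  qed
  then show ?thesis by (simp add: double_words_iff)
qed

lemma set_label_occurrences_double_words:
  "s \<in> double_words n \<Longrightarrow> set (label_occurrences s) = {1..n} \<times> {1..2}"
  by (auto simp: set_label_occurrences double_words_iff split: if_splits)

lemma map_in_double_words:
  assumes "\<sigma> permutes {1..n}" "s \<in> double_words n"
  shows "map \<sigma> s \<in> double_words n"
proof -
  have "inj \<sigma>" using assms(1) permutes_inj by blast
  have "count_list (map \<sigma> s) i = (if i \<in> {1..n} then 2 else 0)" for i
  proof -
    have "count_list (map \<sigma> s) (\<sigma> (inv \<sigma> i)) = (if inv \<sigma> i \<in> {1..n} then 2 else 0)"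
      using assms(2) count_list_map_conv[OF \<open>inj \<sigma>\<close>] by (simp add: double_words_iff)
    then show ?thesis
      using permutes_inverses[OF assms(1)] permutes_in_image[OF permutes_inv[OF assms(1)]] by simp
  qed
  then show ?thesis by (simp add: double_words_iff)
qed

section \<open>The permutation of first occurrences\<close>

lemma length_first_occurrences:
  "s \<in> double_words n \<Longrightarrow> length (first_occurrences s) = n"
  using distinct_card[of "first_occurrences s"] by (simp add: set_double_words)

lemma birth_perm_permutes:
  assumes "s \<in> double_words n"
  shows "birth_perm n s permutes {1..n}"
proof -
  have len: "length [1..<Suc n] = length (first_occurrences s)"
    using length_first_occurrences[OF assms] by (simp del: upt_Suc)
  have "set (first_occurrences s) = set [1..<Suc n]"
    unfolding set_first_occurrences set_double_words[OF assms] by (simp add: atLeastLessThanSuc_atLeastAtMost del: upt_Suc)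
  then have "list_permutes (zip [1..<Suc n] (first_occurrences s)) {1..n}"
    unfolding list_permutes_def map_fst_zip[OF len] map_snd_zip[OF len]
    by (simp add: atLeastLessThanSuc_atLeastAtMost del: upt_Suc)
  then show ?thesis
    unfolding birth_perm_def by (rule permutation_of_list_permutes)
qed

text \<open>The shift \<open>i - 1\<close> passes from one-line notation, which starts at 1, to list
  positions, which start at 0.\<close>

lemma birth_perm_nth:
  assumes "s \<in> double_words n" "i \<in> {1..n}"
  shows "birth_perm n s i = first_occurrences s ! (i - 1)"
proof -
  have "map_of (zip [1..<Suc n] (first_occurrences s)) ([1..<Suc n] ! (i - 1)) =
    Some (first_occurrences s ! (i - 1))"
    using assms length_first_occurrences[OF assms(1)]
    by (intro map_of_zip_nth) (auto simp del: upt_Suc)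
  then show ?thesis
    using assms(2) by (simp add: birth_perm_def permutation_of_list_def del: upt_Suc)
qed

text \<open>An injective renaming acts entrywise on the list of first occurrences, and outside
  \<open>{1..n}\<close> both sides fix \<open>i\<close>. This equivariance is why the canonical word
  does not depend on the representative.\<close>

lemma birth_perm_map:
  assumes "\<sigma> permutes {1..n}" "s \<in> double_words n"
  shows "birth_perm n (map \<sigma> s) = \<sigma> \<circ> birth_perm n s"
proof
  fix i
  have s': "map \<sigma> s \<in> double_words n" by (rule map_in_double_words) (fact assms)+
  show "birth_perm n (map \<sigma> s) i = (\<sigma> \<circ> birth_perm n s) i"
  proof (cases "i \<in> {1..n}")
    case True
    then have "i - 1 < n" by auto
    then show ?thesis
      using True assms s' permutes_inj[OF assms(1)]
      by (simp add: birth_perm_nth first_occurrences_map length_first_occurrences)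
  next
    case False
    then show ?thesis
      using permutes_not_in[OF birth_perm_permutes[OF s']] assms
        permutes_not_in[OF birth_perm_permutes[OF assms(2)]]
        permutes_not_in[OF assms(1)] by simp
  qed
qed

lemma word_orbit_self: "s \<in> word_orbit n s"
proof -
  have "s = map id s" by simp
  then show ?thesis unfolding word_orbit_def using permutes_id[of "{1..n}"] by blast
qed

text \<open>For \<open>t = map \<sigma> s\<close> the factor \<open>inv \<sigma>\<close> in
  \<open>inv (birth_perm n t)\<close> undoes the renaming. The image in the definition is therefore
  a singleton, and \<open>the_elem\<close> has a determined value.\<close>

lemma canonical_word_orbit:
  assumes "s \<in> double_words n"
  shows "canonical_word n (word_orbit n s) = map (inv (birth_perm n s)) s"
proof -
  have "map (inv (birth_perm n t)) t = map (inv (birth_perm n s)) s" if t: "t \<in> word_orbit n s" for t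
  proof -
    obtain \<sigma> where \<sigma>: "\<sigma> permutes {1..n}" "t = map \<sigma> s"
      using t by (auto simp: word_orbit_def)
    have "inv (birth_perm n t) = inv (birth_perm n s) \<circ> inv \<sigma>"
      using \<sigma> birth_perm_map[OF \<sigma>(1) assms]
        o_inv_distrib[OF permutes_bij[OF \<sigma>(1)] permutes_bij[OF birth_perm_permutes[OF assms]]]
      by simp
    then show ?thesis using \<sigma> permutes_inv_o(2)[OF \<sigma>(1)] by (simp add: o_assoc[symmetric])
  qed
  then have "(\<lambda>t. map (inv (birth_perm n t)) t) ` word_orbit n s = {map (inv (birth_perm n s)) s}"
    using word_orbit_self by blast
  then show ?thesis by (simp add: canonical_word_def)
qed

lemma word_orbit_map:
  assumes "\<sigma> permutes {1..n}"
  shows "word_orbit n (map \<sigma> s) = word_orbit n s"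
proof -
  have "map \<pi> (map \<sigma> s) \<in> word_orbit n s" if "\<pi> permutes {1..n}" for \<pi>
  proof -
    have "map \<pi> (map \<sigma> s) = map (\<pi> \<circ> \<sigma>) s" by simp
    then show ?thesis
      unfolding word_orbit_def using permutes_compose[OF assms that] by blast
  qed
  moreover have "map \<pi> s \<in> word_orbit n (map \<sigma> s)" if "\<pi> permutes {1..n}" for \<pi>
  proof -
    have "map \<pi> s = map (\<pi> \<circ> inv \<sigma>) (map \<sigma> s)"
      using permutes_inverses[OF assms] by simp
    then show ?thesis
      unfolding word_orbit_def using permutes_compose[OF permutes_inv[OF assms] that] by blast
  qed
  ultimately show ?thesis
    unfolding word_orbit_def[of n "map \<sigma> s"] word_orbit_def[of n s] by blast
qed

text \<open>The labellings of the words \<open>canonical_word n X\<close>, described without mention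
  of orbits. All order conditions are memberships in \<open>order_pairs\<close>, so they survive any
  change that keeps the pairs in question.\<close>

definition canonical_labellings :: "nat \<Rightarrow> (nat \<times> nat) list set" where
  "canonical_labellings n = {L. distinct L \<and> set L = {1..n} \<times> {1..2} \<and>
     (\<forall>i\<in>{1..n}. ((i, 1), (i, 2)) \<in> order_pairs L) \<and>
     (\<forall>i\<in>{1..n}. \<forall>j\<in>{1..n}. i < j \<longrightarrow> ((i, 1), (j, 1)) \<in> order_pairs L)}"

definition barcode_labelling :: "nat \<Rightarrow> nat list set \<Rightarrow> (nat \<times> nat) list" where
  "barcode_labelling n X = label_occurrences (canonical_word n X)"

lemma well_labelledI:
  fixes L :: "(nat \<times> nat) list"
  assumes "distinct L" "set L = {1..n} \<times> {1..2}"
    "\<And>i. i \<in> {1..n} \<Longrightarrow> ((i, 1), (i, 2)) \<in> order_pairs L"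
  shows "well_labelled L"
  unfolding well_labelled_def
proof (intro conjI ballI)
  fix u assume "u \<in> set L"
  then obtain i k where u: "u = (i, k)" "i \<in> {1..n}" "k = 1 \<or> k = 2"
    unfolding assms(2) by force
  have "((i, l), (i, k)) \<in> order_pairs L" if "1 \<le> l" "l < k" for l
  proof -
    have "l = 1 \<and> k = 2" using that u(3) by auto
    then show ?thesis using assms(3)[OF u(2)] by simp
  qed
  then show "case u of (i, k) \<Rightarrow> 1 \<le> k \<and> (\<forall>l. 1 \<le> l \<and> l < k \<longrightarrow> ((i, l), (i, k)) \<in> order_pairs L)"
    using u by auto
qed (fact assms)

lemma canonical_labellings_well_labelled: "L \<in> canonical_labellings n \<Longrightarrow> well_labelled L"
  using well_labelledI[of L n] unfolding canonical_labellings_def by blast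

text \<open>The first occurrences of \<open>s\<close> are the values of
  \<open>birth_perm n s\<close> at 1, ..., n, and the inverse permutation turns them back into their
  arguments.\<close>

lemma first_occurrences_map_birth_perm:
  assumes "s \<in> double_words n"
  shows "first_occurrences (map (inv (birth_perm n s)) s) = [1..<Suc n]"
proof -
  let ?\<tau> = "birth_perm n s"
  have \<tau>: "?\<tau> permutes {1..n}" by (rule birth_perm_permutes) fact
  have "first_occurrences s = map ?\<tau> [1..<Suc n]"
  proof (rule nth_equalityI)
    fix k assume "k < length (first_occurrences s)"
    then have "k < n" using length_first_occurrences[OF assms] by simp
    then have "[1..<Suc n] ! k = Suc k" by (simp del: upt_Suc)
    then show "first_occurrences s ! k = map ?\<tau> [1..<Suc n] ! k"
      using \<open>k < n\<close> birth_perm_nth[OF assms, of "Suc k"] by (simp del: upt_Suc)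
  qed (use length_first_occurrences[OF assms] in \<open>simp del: upt_Suc\<close>)
  then show ?thesis
    using first_occurrences_map[OF permutes_inj[OF permutes_inv[OF \<tau>]]] permutes_inv_o(2)[OF \<tau>]
    by (simp del: upt_Suc)
qed

lemma order_pairs_upt: "a \<le> i \<Longrightarrow> i < j \<Longrightarrow> j < b \<Longrightarrow> (i, j) \<in> order_pairs [a..<b]"
proof -
  assume "a \<le> i" "i < j" "j < b"
  then have "(i, j) = ([a..<b] ! (i - a), [a..<b] ! (j - a))" "i - a < j - a" "j - a < length [a..<b]"
    by auto
  then show ?thesis unfolding order_pairs_nth by blast
qed

text \<open>Well-labelledness puts each birth before its death, and the increasing first occurrences
  put the births in order.\<close>

lemma label_occurrences_canonical:
  assumes "s \<in> double_words n" "first_occurrences s = [1..<Suc n]"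
  shows "label_occurrences s \<in> canonical_labellings n"
proof -
  let ?L = "label_occurrences s"
  have set_L: "set ?L = {1..n} \<times> {1..2}" by (rule set_label_occurrences_double_words) fact
  have wl: "well_labelled ?L" by (rule well_labelled_label_occurrences)
  have "((i, 1), (i, 2)) \<in> order_pairs ?L" if "i \<in> {1..n}" for i
  proof -
    have "(i, 2) \<in> set ?L" unfolding set_L using that by simp
    moreover have "(1::nat) \<le> 1 \<and> (1::nat) < 2" by simp
    ultimately show ?thesis using wl unfolding well_labelled_def by blast
  qed
  moreover have "((i, 1), (j, 1)) \<in> order_pairs ?L" if "i \<in> {1..n}" "j \<in> {1..n}" "i < j" for i j
  proof -
    have "(i, j) \<in> order_pairs [1..<Suc n]" using that by (intro order_pairs_upt) auto
    then have "((i, 1), (j, 1)) \<in> order_pairs (map (\<lambda>i. (i, 1::nat)) (first_occurrences s))"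
      unfolding assms(2) order_pairs_map by (rule rev_image_eqI) simp
    then show ?thesis
      unfolding filter_label_occurrences[symmetric] using order_pairs_filter by blast
  qed
  ultimately show ?thesis
    using set_L wl unfolding canonical_labellings_def well_labelled_def by blast
qed

text \<open>Both lists are free of duplicates and have the same entries, so sortedness is enough. A
  descent would put a birth before the birth of a lower-numbered bar, against canonicity.\<close>

lemma first_occurrences_canonical:
  assumes "L \<in> canonical_labellings n"
  shows "first_occurrences (map fst L) = [1..<Suc n]"
proof (rule sorted_distinct_set_unique)
  have L: "distinct L" "set L = {1..n} \<times> {1..2}"
    and births: "\<And>i j. i \<in> {1..n} \<Longrightarrow> j \<in> {1..n} \<Longrightarrow> i < j \<Longrightarrow> ((i, 1), (j, 1)) \<in> order_pairs L"
    using assms unfolding canonical_labellings_def by blast+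
  let ?F = "first_occurrences (map fst L)"
  have set_F: "set ?F = {1..n}" using L(2) by force
  then show "set ?F = set [1..<Suc n]"
    by (simp add: atLeastLessThanSuc_atLeastAtMost del: upt_Suc)
  have F: "map (\<lambda>i. (i, 1)) ?F = filter (\<lambda>u. snd u = 1) L"
    using filter_label_occurrences[of "map fst L"]
      label_occurrences_map_fst[OF canonical_labellings_well_labelled[OF assms]] by simp
  show "sorted ?F"
    unfolding sorted_wrt_order_pairs
  proof clarify
    fix i j assume ij: "(i, j) \<in> order_pairs ?F"
    then have "((i, 1), (j, 1)) \<in> order_pairs (map (\<lambda>i. (i, 1::nat)) ?F)"
      unfolding order_pairs_map by (rule rev_image_eqI) simp
    then have "((i, 1), (j, 1)) \<in> order_pairs L" unfolding F using order_pairs_filter by blast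
    then have "((j, 1), (i, 1)) \<notin> order_pairs L" by (rule order_pairs_asym[OF L(1)])
    moreover have "i \<in> {1..n}" "j \<in> {1..n}" using ij order_pairs_subset set_F by blast+
    ultimately show "i \<le> j" using births[of j i] by force
  qed
qed (simp_all del: upt_Suc)

text \<open>The second equation keeps the labels of \<open>s\<close> itself visible, which lets
  inversions be counted on \<open>s\<close>; the third recovers the class from its
  labelling.\<close>

lemma canonical_word_double_word:
  assumes "s \<in> double_words n"
  shows "barcode_labelling n (word_orbit n s) \<in> canonical_labellings n"
    and "barcode_labelling n (word_orbit n s) =
      map (apfst (inv (birth_perm n s))) (label_occurrences s)"
    and "word_orbit n (map fst (barcode_labelling n (word_orbit n s))) = word_orbit n s"
proof -
  have perm: "inv (birth_perm n s) permutes {1..n}"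
    using birth_perm_permutes[OF assms] by (rule permutes_inv)
  have lab: "barcode_labelling n (word_orbit n s) = label_occurrences (map (inv (birth_perm n s)) s)"
    unfolding barcode_labelling_def canonical_word_orbit[OF assms] ..
  show "barcode_labelling n (word_orbit n s) \<in> canonical_labellings n"
    unfolding lab
    by (intro label_occurrences_canonical map_in_double_words first_occurrences_map_birth_perm
        perm assms)
  show "barcode_labelling n (word_orbit n s) =
      map (apfst (inv (birth_perm n s))) (label_occurrences s)"
    unfolding lab by (rule label_occurrences_map[OF permutes_inj[OF perm]])
  show "word_orbit n (map fst (barcode_labelling n (word_orbit n s))) = word_orbit n s"
    unfolding lab map_fst_label_occurrences by (rule word_orbit_map[OF perm])
qed

text \<open>The letters of a canonical labelling first appear in the order 1, ..., n, so the birth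
  permutation is the identity. With \<open>barcode_labelling_canonical\<close> this yields a
  bijection between classes and canonical labellings.\<close>

lemma barcode_labelling_word_orbit:
  assumes "L \<in> canonical_labellings n"
  shows "barcode_labelling n (word_orbit n (map fst L)) = L"
    and "word_orbit n (map fst L) \<in> combinatorial_barcodes n"
proof -
  let ?s = "map fst L"
  have s: "?s \<in> double_words n"
    using assms unfolding canonical_labellings_def by (intro map_fst_in_double_words) auto
  then show "word_orbit n ?s \<in> combinatorial_barcodes n"
    unfolding combinatorial_barcodes_def by blast
  have "birth_perm n ?s = id"
  proof
    fix i show "birth_perm n ?s i = id i"
    proof (cases "i \<in> {1..n}")
      case True
      then have "[1..<Suc n] ! (i - 1) = i" by (auto simp del: upt_Suc)
      then show ?thesis
        using birth_perm_nth[OF s True] first_occurrences_canonical[OF assms] by simp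
    qed (simp add: permutes_not_in[OF birth_perm_permutes[OF s]])
  qed
  then show "barcode_labelling n (word_orbit n ?s) = L"
    unfolding barcode_labelling_def canonical_word_orbit[OF s]
    using label_occurrences_map_fst[OF canonical_labellings_well_labelled[OF assms]] by simp
qed

lemma barcode_labelling_canonical:
  assumes "X \<in> combinatorial_barcodes n"
  shows "barcode_labelling n X \<in> canonical_labellings n"
    and "word_orbit n (map fst (barcode_labelling n X)) = X"
  using assms canonical_word_double_word unfolding combinatorial_barcodes_def by auto

lemma combinatorial_le_inversions:
  "combinatorial_le n X Y \<longleftrightarrow>
     inversions (barcode_labelling n X) \<subseteq> inversions (barcode_labelling n Y)"
  by (simp add: combinatorial_le_def newman_le_def barcode_labelling_def)

text \<open>Antisymmetry of \<open>combinatorial_le\<close>: equal inversions force equal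
  labellings, and a labelling determines its class.\<close>

lemma inversions_barcode_labelling_unique:
  assumes "X \<in> combinatorial_barcodes n" "Y \<in> combinatorial_barcodes n"
    "inversions (barcode_labelling n X) = inversions (barcode_labelling n Y)"
  shows "X = Y"
proof -
  have "barcode_labelling n X = barcode_labelling n Y"
    using assms barcode_labelling_canonical(1)[of _ n] unfolding canonical_labellings_def
    by (intro inversions_eq_imp_eq) blast+
  then show ?thesis using assms(1,2) barcode_labelling_canonical(2) by metis
qed

section \<open>The rank function\<close>

lemma canonical_labelling_step:
  assumes s: "s \<in> canonical_labellings n" and t: "t \<in> canonical_labellings n"
    and sub: "inversions s \<subset> inversions t"
  obtains u where "u \<in> canonical_labellings n" "inversions s \<subseteq> inversions u"
    "inversions u \<subseteq> inversions t" "card (inversions u) = Suc (card (inversions s))"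
proof -
  have dist: "distinct s" "distinct t" "set s = set t"
    using s t unfolding canonical_labellings_def by auto
  have "s \<noteq> t" using sub by blast
  then obtain us x y vs where s_eq: "s = us @ [x, y] @ vs" and xy: "(x, y) \<notin> order_pairs t"
    using ex_adjacent_disorder[OF dist(2,1,3)] by blast
  let ?u = "us @ [y, x] @ vs"
  have ne: "x \<noteq> y" using dist(1) s_eq by auto
  have yx: "(y, x) \<in> order_pairs t"
    using order_pairs_total[of x t y] xy ne dist(3) s_eq by auto
  have xy_s: "(x, y) \<in> order_pairs s" using s_eq by simp
  have yx_s: "(y, x) \<notin> order_pairs s" using order_pairs_asym[OF dist(1) xy_s] .
  \<comment> \<open>Exchanging two neighbours changes the relative order of no other pair.\<close>
  have u_supset: "order_pairs s - {(x, y)} \<subseteq> order_pairs ?u" unfolding s_eq by auto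
  have u_subset: "order_pairs ?u \<subseteq> insert (y, x) (order_pairs s)" unfolding s_eq by auto
  have u_yx: "(y, x) \<in> order_pairs ?u" by simp
  \<comment> \<open>Otherwise (x, y) would be an inversion of \<open>s\<close> and hence of
    \<open>t\<close>, where \<open>y\<close> comes before \<open>x\<close>.\<close>
  have less: "label_less x y"
  proof (rule ccontr)
    assume "\<not> label_less x y"
    then have "label_less y x" using ne label_less_linear by blast
    then have "(x, y) \<in> inversions s" using xy_s by (simp add: inversions_order_pairs)
    then show False using sub xy unfolding inversions_order_pairs by blast
  qed
  have "inversions ?u = insert (y, x) (inversions s)"
    using u_supset u_subset u_yx less label_less_asym[OF less]
    unfolding inversions_order_pairs by blast
  moreover have "(y, x) \<notin> inversions s" using yx_s by (simp add: inversions_order_pairs)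
  moreover have "(y, x) \<in> inversions t" using yx less by (simp add: inversions_order_pairs)
  moreover have "?u \<in> canonical_labellings n"
  proof -
    \<comment> \<open>The pairs required by canonicity lie in \<open>order_pairs\<close> of both
      \<open>s\<close> and \<open>t\<close>. The swap destroys only (x, y), which \<open>t\<close>
      lacks.\<close>
    have "order_pairs s \<inter> order_pairs t \<subseteq> order_pairs ?u" using u_supset xy by blast
    moreover have "distinct ?u" "set ?u = set s" using dist(1) s_eq by auto
    ultimately show ?thesis using s t unfolding canonical_labellings_def by blast
  qed
  ultimately show thesis using sub by (intro that[of ?u]) auto
qed

text \<open>The swap carried over to classes. It serves twice: applied to a cover it pins down the
  upper element, and repeated it builds saturated chains.\<close>

lemma combinatorial_step:
  assumes X: "X \<in> combinatorial_barcodes n" and Y: "Y \<in> combinatorial_barcodes n"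
    and le: "combinatorial_le n X Y" and ne: "X \<noteq> Y"
  obtains Z where "Z \<in> combinatorial_barcodes n" "combinatorial_le n X Z" "combinatorial_le n Z Y"
    "card (inversions (barcode_labelling n Z)) = Suc (card (inversions (barcode_labelling n X)))"
proof -
  have "inversions (barcode_labelling n X) \<subset> inversions (barcode_labelling n Y)"
    using le ne inversions_barcode_labelling_unique[OF X Y] unfolding combinatorial_le_inversions
    by blast
  then obtain u where "u \<in> canonical_labellings n"
    "inversions (barcode_labelling n X) \<subseteq> inversions u"
    "inversions u \<subseteq> inversions (barcode_labelling n Y)"
    "card (inversions u) = Suc (card (inversions (barcode_labelling n X)))"
    using canonical_labelling_step barcode_labelling_canonical(1)[OF X]
      barcode_labelling_canonical(1)[OF Y] by blast
  then show thesis
    using that[of "word_orbit n (map fst u)"] barcode_labelling_word_orbit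
    unfolding combinatorial_le_inversions by metis
qed

section \<open>The minimum class and the rank function\<close>

lemma sorted_product_labels:
  "sorted_wrt (<) xs \<Longrightarrow> sorted_wrt label_less (List.product xs [1, 2])"
  by (induction xs) (auto simp: sorted_wrt_append)

text \<open>The witness is the word 1 1 2 2 ... n n, the class of pairwise disjoint bars: its labels
  appear in increasing order, so nothing is inverted.\<close>

lemma ex_minimum_barcode:
  obtains M where "M \<in> combinatorial_barcodes n" "inversions (barcode_labelling n M) = {}"
proof -
  let ?L = "List.product [1..<Suc n] [1, 2::nat]"
  have sorted: "\<forall>(u, v) \<in> order_pairs ?L. label_less u v"
    using sorted_product_labels[of "[1..<Suc n]"] unfolding sorted_wrt_order_pairs[symmetric]
    by (simp del: upt_Suc)
  have set_L: "set ?L = {1..n} \<times> {1..2}" by (auto simp del: upt_Suc)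
  \<comment> \<open>In an increasing list the smaller of two labels comes first, and every order
    condition of canonicity asks for a smaller label before a larger one.\<close>
  have in_L: "(u, v) \<in> order_pairs ?L" if "u \<in> set ?L" "v \<in> set ?L" "label_less u v" for u v
    using order_pairs_total[of u ?L v] that sorted label_less_asym by blast
  have "?L \<in> canonical_labellings n"
    unfolding canonical_labellings_def
  proof (intro CollectI conjI ballI impI)
    show "distinct ?L" by (simp add: distinct_product del: upt_Suc)
    show "set ?L = {1..n} \<times> {1..2}" by (fact set_L)
  qed (rule in_L; simp del: upt_Suc)+
  moreover have "inversions ?L = {}"
    using sorted label_less_asym unfolding inversions_order_pairs by blast
  ultimately show thesis using that barcode_labelling_word_orbit by metis
qed

lemma rank_function_card_inversions:
  "rank_function (combinatorial_barcodes n) (combinatorial_le n)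
     (\<lambda>X. card (inversions (barcode_labelling n X)))"
  unfolding rank_function_def
proof (intro conjI ballI allI impI)
  fix X assume "X \<in> combinatorial_barcodes n" "\<forall>Y\<in>combinatorial_barcodes n. combinatorial_le n X Y"
  \<comment> \<open>A least element lies below \<open>M\<close> and so has no inversions
    either.\<close>
  moreover obtain M where "M \<in> combinatorial_barcodes n" "inversions (barcode_labelling n M) = {}"
    using ex_minimum_barcode .
  ultimately show "card (inversions (barcode_labelling n X)) = 0"
    unfolding combinatorial_le_inversions by fastforce
next
  fix X Y assume "X \<in> combinatorial_barcodes n" "Y \<in> combinatorial_barcodes n"
    "combinatorial_le n X Y \<and> X \<noteq> Y"
  then show "card (inversions (barcode_labelling n X)) < card (inversions (barcode_labelling n Y))"
    using inversions_barcode_labelling_unique unfolding combinatorial_le_inversions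
    by (intro psubset_card_mono) auto
next
  fix X Y assume cov: "covers_on (combinatorial_barcodes n) (combinatorial_le n) X Y"
  then obtain Z where Z: "Z \<in> combinatorial_barcodes n" "combinatorial_le n X Z"
    "combinatorial_le n Z Y"
    "card (inversions (barcode_labelling n Z)) = Suc (card (inversions (barcode_labelling n X)))"
    using combinatorial_step[of X n Y] unfolding covers_on_def by metis
  \<comment> \<open>The counts of \<open>Z\<close> and \<open>X\<close> differ by one, so covering
    leaves only \<open>Z = Y\<close>.\<close>
  then have "Z \<noteq> X" by auto
  then have "Z = Y" using cov Z unfolding covers_on_def by blast
  then show "card (inversions (barcode_labelling n Y)) = Suc (card (inversions (barcode_labelling n X)))"
    using Z(4) by simp
qed

text \<open>Any rank function vanishes at the minimum and grows by 1 along each cover of a saturated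
  chain from there to \<open>X\<close>, whose length is the number of inversions. This gives the
  description in \<open>poset_rank\<close> a unique value.\<close>

lemma rank_function_unique:
  assumes rk: "rank_function (combinatorial_barcodes n) (combinatorial_le n) \<rho>"
    and X: "X \<in> combinatorial_barcodes n"
  shows "\<rho> X = card (inversions (barcode_labelling n X))"
proof -
  let ?c = "\<lambda>X. card (inversions (barcode_labelling n X))"
  \<comment> \<open>The claim covers all \<open>Y\<close> below \<open>X\<close>, so that induction
    on the number of inversions still missing can pass from \<open>Y\<close> to the next class
    \<open>Z\<close> of a chain.\<close>
  have chain: "\<rho> X = \<rho> Y + (?c X - ?c Y)"
    if "Y \<in> combinatorial_barcodes n" "combinatorial_le n Y X" for Y
    using that
  proof (induction "?c X - ?c Y" arbitrary: Y rule: less_induct)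
    case less
    show ?case
    proof (cases "Y = X")
      case False
      then obtain Z where Z: "Z \<in> combinatorial_barcodes n" "combinatorial_le n Y Z"
        "combinatorial_le n Z X" "?c Z = Suc (?c Y)"
        using combinatorial_step[OF less.prems(1) X less.prems(2)] by metis
      \<comment> \<open>A class strictly between \<open>Y\<close> and \<open>Z\<close> would have a
        count strictly between two consecutive numbers.\<close>
      have "covers_on (combinatorial_barcodes n) (combinatorial_le n) Y Z"
        unfolding covers_on_def
      proof (intro conjI ballI impI)
        show "Y \<noteq> Z" using Z(4) by auto
        fix W assume W: "W \<in> combinatorial_barcodes n" "combinatorial_le n Y W \<and> combinatorial_le n W Z"
        show "W = Y \<or> W = Z"
        proof (rule ccontr)
          assume "\<not> ?thesis"
          then have "?c Y < ?c W" "?c W < ?c Z"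
            using W Z(1) less.prems(1) rank_function_card_inversions[of n]
            unfolding rank_function_def by metis+
          then show False using Z(4) by simp
        qed
      qed (use Z less.prems in auto)
      then have "\<rho> Z = Suc (\<rho> Y)" using rk unfolding rank_function_def by blast
      \<comment> \<open>With this bound truncated subtraction loses nothing, both in the induction
        measure and in the final sum.\<close>
      moreover have "?c Z \<le> ?c X"
        using Z(3) unfolding combinatorial_le_inversions by (intro card_mono) auto
      moreover have "\<rho> X = \<rho> Z + (?c X - ?c Z)"
        using Z calculation(2) by (intro less.hyps) auto
      ultimately show ?thesis using Z(4) by simp
    qed simp
  qed
  obtain M where M: "M \<in> combinatorial_barcodes n" "inversions (barcode_labelling n M) = {}"
    using ex_minimum_barcode .
  then have min: "\<forall>Y\<in>combinatorial_barcodes n. combinatorial_le n M Y"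
    unfolding combinatorial_le_inversions by simp
  then have "\<rho> M = 0" using rk M(1) unfolding rank_function_def by blast
  then show ?thesis using chain[OF M(1)] min X M(2) by simp
qed

lemma poset_rank_combinatorial:
  assumes "X \<in> combinatorial_barcodes n"
  shows "poset_rank (combinatorial_barcodes n) (combinatorial_le n) X =
    card (inversions (barcode_labelling n X))"
  unfolding poset_rank_def
  using assms rank_function_unique rank_function_card_inversions by (intro the_equality) blast+

section \<open>Inversions and crossings of bars\<close>

definition endpoint :: "(nat \<Rightarrow> real \<times> real) \<Rightarrow> nat \<times> nat \<Rightarrow> real" where
  "endpoint B u = (if snd u = 1 then birth B (fst u) else death B (fst u))"

lemma endpoint_simps: "endpoint B (i, 1) = birth B i" "endpoint B (i, 2) = death B i"
  by (simp_all add: endpoint_def)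

lemma labels_eq: "{1..n} \<times> {1..2} = {1..n} \<times> {1, 2::nat}"
  by auto

lemma strict_barcodeD:
  assumes "strict_barcode n B" "i \<in> {1..n}" "j \<in> {1..n}"
  shows "birth B i < death B i" "birth B i \<noteq> death B j"
    "birth B i = birth B j \<Longrightarrow> i = j" "death B i = death B j \<Longrightarrow> i = j"
  using assms unfolding strict_barcode_def barcode_def by blast+

lemma inj_on_endpoint:
  assumes "strict_barcode n B"
  shows "inj_on (endpoint B) ({1..n} \<times> {1..2})"
proof (rule inj_onI)
  fix u v assume "u \<in> {1..n} \<times> {1..2::nat}" "v \<in> {1..n} \<times> {1..2::nat}" "endpoint B u = endpoint B v"
  moreover obtain i k j l where "u = (i, k)" "v = (j, l)" by (metis surj_pair)
  ultimately have "i \<in> {1..n}" "j \<in> {1..n}" "k = 1 \<or> k = 2" "l = 1 \<or> l = 2"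
    "endpoint B (i, k) = endpoint B (j, l)" by auto
  then have "i = j \<and> k = l"
    using strict_barcodeD[OF assms, of i j] strict_barcodeD(2)[OF assms, of j i]
    by (auto simp: endpoint_def)
  then show "u = v" using \<open>u = (i, k)\<close> \<open>v = (j, l)\<close> by simp
qed

text \<open>Occurrence counts have to be matched with births and deaths. The sorted endpoints,
  replaced by the labels they carry, form a list whose letters spell the barcode word. It is well
  labelled because births precede deaths, so it is the labelling of that word.\<close>

lemma label_occurrences_barcode_word:
  assumes strict: "strict_barcode n B"
  defines "M \<equiv> label_occurrences (barcode_word n B)"
  shows "barcode_word n B \<in> double_words n"
    and "order_pairs M = {(u, v). u \<in> {1..n} \<times> {1..2} \<and> v \<in> {1..n} \<times> {1..2} \<and>
      endpoint B u < endpoint B v}"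
proof -
  let ?S = "{1..n} \<times> {1..2::nat}" and ?ep = "endpoint B"
  \<comment> \<open>\<open>?l\<close> returns the label of an endpoint; strictness makes
    \<open>endpoint B\<close> injective on the labels and so \<open>?l\<close> a genuine
    inverse.\<close>
  let ?E = "sorted_list_of_set (?ep ` ?S)" and ?l = "the_inv_into ?S ?ep"
  let ?L = "map ?l ?E"
  have inj: "inj_on ?ep ?S" by (rule inj_on_endpoint) fact
  have E: "set ?E = ?ep ` ?S" "distinct ?E" "sorted_wrt (<) ?E"
    by (simp_all add: sorted_list_of_set.strict_sorted_key_list_of_set)
  have l: "?l (?ep u) = u" if "u \<in> ?S" for u using inj that by (rule the_inv_into_f_f)
  have dist: "distinct ?L" and set_L: "set ?L = ?S"
    using E(2) inj_on_the_inv_into[OF inj] the_inv_into_onto[OF inj]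
    unfolding distinct_map set_map E(1) by blast+
  have pairs: "order_pairs ?L = {(u, v). u \<in> ?S \<and> v \<in> ?S \<and> ?ep u < ?ep v}" (is "_ = ?R")
  proof
    show sub: "order_pairs ?L \<subseteq> ?R"
    proof (rule subrelI)
      fix u v assume "(u, v) \<in> order_pairs ?L"
      then obtain x y where xy: "(x, y) \<in> order_pairs ?E" "u = ?l x" "v = ?l y"
        unfolding order_pairs_map by auto
      then have "x < y" using E(3) unfolding sorted_wrt_order_pairs by auto
      have "x \<in> ?ep ` ?S" "y \<in> ?ep ` ?S" using xy(1) order_pairs_subset E(1) by blast+
      then show "(u, v) \<in> ?R" using xy l \<open>x < y\<close> by auto
    qed
    \<comment> \<open>Totality leaves two possible orders, and the inclusion just proved excludes
      the reversed one.\<close>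
    show "?R \<subseteq> order_pairs ?L"
    proof (rule subrelI)
      fix u v assume "(u, v) \<in> ?R"
      then have uv: "u \<in> ?S" "v \<in> ?S" "?ep u < ?ep v" by auto
      then have "(u, v) \<in> order_pairs ?L \<or> (v, u) \<in> order_pairs ?L"
        by (intro order_pairs_total) (unfold set_L, auto)
      moreover have "(v, u) \<notin> ?R" using uv(3) by auto
      ultimately show "(u, v) \<in> order_pairs ?L" using sub by blast
    qed
  qed
  have bar: "bar_of_endpoint n B x = fst (?l x)" if "x \<in> ?ep ` ?S" for x
  proof -
    obtain u where u: "u \<in> ?S" "x = ?ep u" using \<open>x \<in> ?ep ` ?S\<close> by blast
    have "bar_of_endpoint n B x = fst u"
      unfolding bar_of_endpoint_def
    proof (rule the_equality)
      show "fst u \<in> {1..n} \<and> (x = birth B (fst u) \<or> x = death B (fst u))"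
        using u by (auto simp: endpoint_def)
      fix i assume i: "i \<in> {1..n} \<and> (x = birth B i \<or> x = death B i)"
      then have "\<exists>k\<in>{1, 2}. ?ep u = ?ep (i, k)" using u(2) by (simp add: endpoint_def)
      then obtain k where "k \<in> {1, 2}" "?ep u = ?ep (i, k)" by blast
      then have "u = (i, k)" using i u(1) by (intro inj_onD[OF inj]) auto
      then show "i = fst u" by simp
    qed
    then show ?thesis using l u by simp
  qed
  have endpoints: "?ep ` ?S = birth B ` {1..n} \<union> death B ` {1..n}"
  proof -
    have "?S = (\<lambda>i. (i, 1)) ` {1..n} \<union> (\<lambda>i. (i, 2)) ` {1..n}"
      unfolding labels_eq by auto
    then show ?thesis by (simp only: image_Un image_image endpoint_simps)
  qed
  have word: "barcode_word n B = map fst ?L"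
    unfolding barcode_word_def endpoints[symmetric] map_map
    by (rule map_cong[OF refl]) (simp only: E(1) bar o_apply)
  show "barcode_word n B \<in> double_words n"
    unfolding word by (rule map_fst_in_double_words[OF dist set_L])
  have "((i, 1), (i, 2)) \<in> order_pairs ?L" if "i \<in> {1..n}" for i
    unfolding pairs using that strict by (auto simp: strict_barcode_def barcode_def endpoint_def)
  then have "well_labelled ?L" by (rule well_labelledI[OF dist set_L])
  then have "M = ?L" unfolding M_def word by (rule label_occurrences_map_fst)
  then show "order_pairs M = ?R" using pairs by simp
qed

text \<open>The birth of \<open>i\<close> comes before both endpoints of \<open>j\<close>, so only
  its death can be preceded by them: (1, 2) counts when \<open>j\<close> is born before
  \<open>i\<close> dies, and (2, 2) when \<open>j\<close> also dies before \<open>i\<close>.\<close>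

lemma card_crossings:
  assumes "strict_barcode n B" "i \<in> {1..n}" "j \<in> {1..n}" "birth B i < birth B j"
  shows "card {(k, l). k \<in> {1..2} \<and> l \<in> {1..2} \<and> endpoint B (j, k) < endpoint B (i, l)} =
    crossing_number B i j"
proof -
  let ?C = "{(k, l). k \<in> {1..2} \<and> l \<in> {1..2} \<and> endpoint B (j, k) < endpoint B (i, l)}"
  have C: "?C = {(k, l). k \<in> {1, 2} \<and> l \<in> {1, 2} \<and> endpoint B (j, k) < endpoint B (i, l)}" by force
  have "birth B j < death B j" "i \<noteq> j" "death B i \<noteq> birth B j" "death B i \<noteq> death B j"
    using strict_barcodeD[OF assms(1-3)] strict_barcodeD[OF assms(1,3,2)] assms(4) by auto
  then consider "death B i < birth B j" | "birth B j < death B i" "death B i < death B j"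
    | "death B j < death B i" by linarith
  then show ?thesis
  proof cases
    case 1
    have "?C = {}" unfolding C using 1 assms(4) \<open>birth B j < death B j\<close> by (auto simp: endpoint_def)
    show ?thesis unfolding \<open>?C = {}\<close> using 1 by (simp add: crossing_number_def)
  next
    case 2
    then have "?C = {(1, 2)}" unfolding C using assms(4) \<open>birth B j < death B j\<close>
      by (auto simp: endpoint_def)
    then show ?thesis using 2 by (simp add: crossing_number_def)
  next
    case 3
    then have "?C = {(1, 2), (2, 2)}" unfolding C using assms(4) \<open>birth B j < death B j\<close>
      by (auto simp: endpoint_def)
    then show ?thesis using 3 \<open>birth B j < death B j\<close> by (simp add: crossing_number_def)
  qed
qed

theorem corollary1:
  fixes n :: nat and B :: "nat \<Rightarrow> real \<times> real"
  assumes "strict_barcode n B"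
  shows "poset_rank (combinatorial_barcodes n) (combinatorial_le n) (barcode_class n B) =
    (\<Sum>(i, j) \<in> {(i, j). i \<in> {1..n} \<and> j \<in> {1..n} \<and> birth B i < birth B j}. crossing_number B i j)"
proof -
  define s where "s = barcode_word n B"
  define M where "M = label_occurrences s"
  \<comment> \<open>This permutation sends each bar to its place in the order of births.\<close>
  define \<sigma> where "\<sigma> = inv (birth_perm n s)"
  let ?L = "map (apfst \<sigma>) M" and ?S = "{1..n} \<times> {1..2::nat}"
  let ?I = "{(i, j). i \<in> {1..n} \<and> j \<in> {1..n} \<and> birth B i < birth B j}"
  let ?C = "\<lambda>(i, j). {(k, l). k \<in> {1..2} \<and> l \<in> {1..2} \<and> endpoint B (j, k) < endpoint B (i, l)}"
  have s: "s \<in> double_words n" unfolding s_def by (rule label_occurrences_barcode_word) fact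
  have M: "order_pairs M = {(u, v). u \<in> ?S \<and> v \<in> ?S \<and> endpoint B u < endpoint B v}"
    unfolding M_def s_def by (rule label_occurrences_barcode_word) fact
  have \<sigma>: "\<sigma> permutes {1..n}"
    unfolding \<sigma>_def by (rule permutes_inv[OF birth_perm_permutes[OF s]])
  have lab: "barcode_labelling n (barcode_class n B) = ?L"
    using canonical_word_double_word(2)[OF s] unfolding barcode_class_def s_def M_def \<sigma>_def .
  have L: "?L \<in> canonical_labellings n"
    using canonical_word_double_word(1)[OF s] lab unfolding barcode_class_def s_def by simp
  \<comment> \<open>If \<sigma> reversed the two numbers, canonicity of \<open>?L\<close> would put
    the birth of \<open>j\<close> before that of \<open>i\<close>.\<close>
  have mono: "\<sigma> i < \<sigma> j" if "i \<in> {1..n}" "j \<in> {1..n}" "birth B i < birth B j" for i j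
  proof (rule ccontr)
    assume "\<not> \<sigma> i < \<sigma> j"
    moreover have "\<sigma> i \<noteq> \<sigma> j" using permutes_inj[OF \<sigma>] that(3) by (metis injD less_irrefl)
    moreover have "\<sigma> i \<in> {1..n}" "\<sigma> j \<in> {1..n}" using permutes_in_image[OF \<sigma>] that by blast+
    ultimately have "((\<sigma> j, 1), (\<sigma> i, 1)) \<in> order_pairs ?L"
      using L unfolding canonical_labellings_def by force
    moreover have "((i, 1), (j, 1)) \<in> order_pairs M" unfolding M using that by (simp add: endpoint_def)
    then have "((\<sigma> i, 1), (\<sigma> j, 1)) \<in> order_pairs ?L"
      unfolding order_pairs_map by (rule rev_image_eqI) simp
    moreover have "distinct ?L" using L unfolding canonical_labellings_def by blast
    ultimately show False using order_pairs_asym by metis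
  qed
  have mono_iff: "\<sigma> i < \<sigma> j \<longleftrightarrow> birth B i < birth B j" if "i \<in> {1..n}" "j \<in> {1..n}" for i j
    using mono[of i j] mono[of j i] that assms unfolding strict_barcode_def
    by (metis less_asym' less_irrefl linorder_neqE)
  have inj: "inj (apfst \<sigma> :: nat \<times> nat \<Rightarrow> nat \<times> nat)"
    using permutes_inj[OF \<sigma>] by (auto simp: inj_def)
  \<comment> \<open>Bar \<open>j\<close> is born later and gets the larger number, so its label
    stands first in the inversion.\<close>
  define h :: "(nat \<times> nat) \<times> (nat \<times> nat) \<Rightarrow> (nat \<times> nat) \<times> (nat \<times> nat)"
    where "h = (\<lambda>((i, j), (k, l)). ((j, k), (i, l)))"
  have h_image: "h ` Sigma ?I ?C = {(u, v) \<in> order_pairs M. label_less (apfst \<sigma> v) (apfst \<sigma> u)}"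
    (is "_ = ?R")
  proof (intro equalityI subsetI)
    fix p assume "p \<in> h ` Sigma ?I ?C"
    then show "p \<in> ?R" unfolding M h_def using mono by auto
  next
    fix p assume p: "p \<in> ?R"
    obtain j k i l where p_eq: "p = ((j, k), (i, l))" by (metis surj_pair)
    have ij: "i \<in> {1..n}" "j \<in> {1..n}" "k \<in> {1..2}" "l \<in> {1..2}"
      "endpoint B (j, k) < endpoint B (i, l)" and less: "\<sigma> i < \<sigma> j \<or> \<sigma> i = \<sigma> j \<and> l < k"
      using p unfolding p_eq M by auto
    \<comment> \<open>The two labels of a single bar are never inverted, since birth precedes
      death.\<close>
    have "\<not> (\<sigma> i = \<sigma> j \<and> l < k)"
    proof
      assume "\<sigma> i = \<sigma> j \<and> l < k"
      then have "i = j" "l = 1" "k = 2" using permutes_inj[OF \<sigma>] ij by (auto dest: injD)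
      moreover have "birth B i < death B i"
        using ij(1) assms unfolding strict_barcode_def barcode_def by blast
      ultimately show False using ij(5) by (simp add: endpoint_def)
    qed
    then have "birth B i < birth B j" using less mono_iff ij by blast
    then have "((i, j), (k, l)) \<in> Sigma ?I ?C" using ij by simp
    then show "p \<in> h ` Sigma ?I ?C" unfolding p_eq h_def by force
  qed
  \<comment> \<open>Renumbering the bars is injective on labels, so the inversions can be counted on
    the labels of the original word, where order means comparison of endpoints.\<close>
  have inv_L: "inversions ?L = map_prod (apfst \<sigma>) (apfst \<sigma>) ` ?R"
    by (rule inversions_map)
  have inj_prod: "inj_on (map_prod (apfst \<sigma>) (apfst \<sigma>)) ?R"
    using map_prod_inj_on[OF inj inj] by (auto intro: inj_on_subset)
  have inj_h: "inj_on h (Sigma ?I ?C)" unfolding h_def by (auto simp: inj_on_def)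
  have "card (inversions ?L) = card ?R"
    unfolding inv_L by (rule card_image[OF inj_prod])
  also have "\<dots> = card (Sigma ?I ?C)"
    unfolding h_image[symmetric] by (rule card_image[OF inj_h])
  also have "\<dots> = (\<Sum>p\<in>?I. card (?C p))"
  proof (rule card_SigmaI)
    show "finite ?I" by (rule finite_subset[of _ "{1..n} \<times> {1..n}"]) auto
    have "?C p \<subseteq> {1..2} \<times> {1..2}" for p by (auto split: prod.splits)
    then show "\<forall>p\<in>?I. finite (?C p)" by (meson finite_SigmaI finite_atLeastAtMost finite_subset)
  qed
  also have "\<dots> = (\<Sum>(i, j)\<in>?I. crossing_number B i j)"
  proof (rule sum.cong)
    fix p assume "p \<in> ?I"
    then obtain i j where "p = (i, j)" "i \<in> {1..n}" "j \<in> {1..n}" "birth B i < birth B j" by blast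
    then show "card (?C p) = (case p of (i, j) \<Rightarrow> crossing_number B i j)"
      using card_crossings[OF assms] by (simp only: prod.case)
  qed simp
  finally have "card (inversions ?L) = (\<Sum>(i, j)\<in>?I. crossing_number B i j)" .
  moreover have "barcode_class n B \<in> combinatorial_barcodes n"
    using s unfolding barcode_class_def s_def combinatorial_barcodes_def by blast
  ultimately show ?thesis using poset_rank_combinatorial lab by simp
qed

end
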